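(* Let $N\ge 2$, let $U$ be a nonempty set, and let $f=(f_1,\dots,f_N)$ with $f_i\colon U\to\mathbb{R}\cup\{+\infty\}$ for $i=1,\dots,N$, such that $\operatorname{dom} f\neq\varnothing$. For $\lambda\in\Delta_N^\circ$ let $H_\lambda(u)=\sum_{i=1}^N\lambda_i f_i(u)$ and $\mathcal{M}_\lambda=\operatorname{argmin}_{u\in U}H_\lambda(u)$. Then, for almost every $\lambda\in\Delta_N^\circ$, the implication $$u_1,u_2\in\mathcal{M}_\lambda\quad\Longrightarrow\quad f(u_1)=f(u_2)$$ holds. Equivalently, for almost every $\lambda\in\Delta_N^\circ$, the set $f(\mathcal{M}_\lambda)$ contains at most one point.
   Context: $U$ is an arbitrary nonempty set; no topology, convexity, compactness or lower semicontinuity is assumed. The domain is $\operatorname{dom} f=\{u\in U: f_i(u)<+\infty \text{ for every } i=1,\dots,N\}$. The open simplex is $\Delta_N^\circ=\{\lambda\in(0,+\infty)^N:\sum_{i=1}^N\lambda_i=1\}$. "Almost every $\lambda\in\Delta_N^\circ$" is with respect to the natural $(N-1)$-dimensional Lebesgue measure on $\Delta_N^\circ$. The value function is $V(\lambda)=\inf_{u\in U}H_\lambda(u)\in[-\infty,+\infty)$, and $u\in\mathcal{M}_\lambda$ if and only if $H_\lambda(u)=V(\lambda)$; $\mathcal{M}_\lambda$ may be empty. A sum with a term equal to $+\infty$ is $+\infty$. *)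

theory Defs
  imports "HOL-Analysis.Analysis"
begin

text \<open>Vectors with components indexed by \<open>1, \<dots>, N\<close> are functions on \<open>nat\<close> that are
  \<^const>\<open>undefined\<close> outside \<open>{1..N}\<close> (elements of a \<^const>\<open>PiE\<close>), so that equality of functions
  is equality of vectors.\<close>

definition open_simplex :: "nat \<Rightarrow> (nat \<Rightarrow> real) set" where
  "open_simplex N = {l \<in> {1..N} \<rightarrow>\<^sub>E {0<..}. (\<Sum>i=1..N. l i) = 1}"

text \<open>The open simplex is the graph of the affine map \<open>x \<mapsto> 1 - x\<^sub>1 - \<dots> - x\<^bsub>N-1\<^esub>\<close>
  over the following open subset of the space of the first \<open>N - 1\<close> coordinates.\<close>

definition simplex_chart :: "nat \<Rightarrow> (nat \<Rightarrow> real) set" where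
  "simplex_chart N = {x \<in> {1..<N} \<rightarrow>\<^sub>E {0<..}. (\<Sum>i\<in>{1..<N}. x i) < 1}"

definition simplex_param :: "nat \<Rightarrow> (nat \<Rightarrow> real) \<Rightarrow> nat \<Rightarrow> real" where
  "simplex_param N x = x(N := 1 - (\<Sum>i\<in>{1..<N}. x i))"

text \<open>The \<open>(N - 1)\<close>-dimensional Lebesgue (surface) measure on the open simplex: Lebesgue measure
  of the first \<open>N - 1\<close> coordinates, transported to the graph. The area element of the graph is
  constant, equal to \<open>sqrt (1 + (N - 1)) = sqrt N\<close>. The sigma-algebra is the Borel one; since
  \<^const>\<open>almost_everywhere\<close> only asks for the exceptional set to be contained in a null set,
  completing the measure would not change the meaning of "almost every".\<close>

definition simplex_lebesgue :: "nat \<Rightarrow> (nat \<Rightarrow> real) measure" where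
  "simplex_lebesgue N = scale_measure (ennreal (sqrt (real N)))
     (distr (restrict_space (\<Pi>\<^sub>M i\<in>{1..<N}. lborel) (simplex_chart N))
            (restrict_space (\<Pi>\<^sub>M i\<in>{1..N}. borel) (open_simplex N))
            (simplex_param N))"

definition weighted_sum :: "nat \<Rightarrow> ('u \<Rightarrow> nat \<Rightarrow> ereal) \<Rightarrow> (nat \<Rightarrow> real) \<Rightarrow> 'u \<Rightarrow> ereal" where
  "weighted_sum N f l u = (\<Sum>i=1..N. ereal (l i) * f u i)"

definition eff_dom :: "nat \<Rightarrow> 'u set \<Rightarrow> ('u \<Rightarrow> nat \<Rightarrow> ereal) \<Rightarrow> 'u set" where
  "eff_dom N U f = {u \<in> U. \<forall>i\<in>{1..N}. f u i < \<infinity>}"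

text \<open>The set of minimisers; the infimum may be \<open>-\<infinity>\<close>, and the set may be empty.\<close>

definition argmin_on :: "'u set \<Rightarrow> ('u \<Rightarrow> ereal) \<Rightarrow> 'u set" where
  "argmin_on U h = {u \<in> U. h u = (INF v\<in>U. h v)}"

text \<open>The chart is measurable and the parametrisation is a measurable bijection onto the simplex,
  so \<^const>\<open>distr\<close> and \<^const>\<open>restrict_space\<close> above are not used degenerately.\<close>

lemma sets_simplex_chart: "simplex_chart N \<in> sets (\<Pi>\<^sub>M i\<in>{1..<N}. lborel)"
proof -
  let ?M = "\<Pi>\<^sub>M i\<in>{1..<N}. (lborel :: real measure)"
  have "simplex_chart N = {x \<in> space ?M. (\<forall>i\<in>{1..<N}. 0 < x i) \<and> (\<Sum>i\<in>{1..<N}. x i) < 1}"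
    by (auto simp: simplex_chart_def space_PiM PiE_iff)
  also have "\<dots> \<in> sets ?M"
    by measurable
  finally show ?thesis .
qed

lemma bij_betw_simplex_param:
  assumes "N \<ge> 1"
  shows "bij_betw (simplex_param N) (simplex_chart N) (open_simplex N)"
proof (rule bij_betw_byWitness[where f' = "\<lambda>l. restrict l {1..<N}"])
  have split: "(\<Sum>i=1..N. g i) = (\<Sum>i\<in>{1..<N}. g i) + g N" for g :: "nat \<Rightarrow> real"
    using assms by (simp add: sum.last_plus add.commute)
  have eq: "(\<Sum>i\<in>{1..<N}. (x(N := c)) i) = (\<Sum>i\<in>{1..<N}. x i)" for x :: "nat \<Rightarrow> real" and c
    by (rule sum.cong) auto
  show "\<forall>x\<in>simplex_chart N. restrict (simplex_param N x) {1..<N} = x"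
    by (auto simp: simplex_chart_def simplex_param_def PiE_iff extensional_def restrict_def)
  show "\<forall>l\<in>open_simplex N. simplex_param N (restrict l {1..<N}) = l"
  proof (intro ballI ext)
    fix l i assume l: "l \<in> open_simplex N"
    then have "l N = 1 - (\<Sum>i\<in>{1..<N}. l i)" "i \<notin> {1..N} \<Longrightarrow> l i = undefined"
      using split[of l] by (auto simp: open_simplex_def PiE_iff extensional_def)
    then show "simplex_param N (restrict l {1..<N}) i = l i"
      by (auto simp: simplex_param_def)
  qed
  show "simplex_param N ` simplex_chart N \<subseteq> open_simplex N"
  proof safe
    fix x assume x: "x \<in> simplex_chart N"
    have "(\<Sum>i=1..N. simplex_param N x i) = 1"
      unfolding split unfolding simplex_param_def eq by simp
    moreover have "simplex_param N x \<in> {1..N} \<rightarrow>\<^sub>E {0<..}"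
      using x assms by (auto simp: simplex_chart_def simplex_param_def PiE_iff extensional_def)
    ultimately show "simplex_param N x \<in> open_simplex N"
      by (simp add: open_simplex_def)
  qed
  show "(\<lambda>l. restrict l {1..<N}) ` open_simplex N \<subseteq> simplex_chart N"
  proof safe
    fix l assume "l \<in> open_simplex N"
    then have "\<And>i. i \<in> {1..N} \<Longrightarrow> l i > 0" "(\<Sum>i\<in>{1..<N}. l i) + l N = 1"
      using split[of l] by (auto simp: open_simplex_def PiE_iff)
    moreover have "l N > 0"
      using calculation(1)[of N] assms by simp
    ultimately show "restrict l {1..<N} \<in> simplex_chart N"
      by (auto simp: simplex_chart_def)
  qed
qed

lemma measurable_simplex_param:
  assumes "N \<ge> 1"
  shows "simplex_param N \<in> restrict_space (\<Pi>\<^sub>M i\<in>{1..<N}. lborel) (simplex_chart N)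
    \<rightarrow>\<^sub>M restrict_space (\<Pi>\<^sub>M i\<in>{1..N}. borel) (open_simplex N)"
proof (rule measurable_restrict_space3)
  have N: "insert N {1..<N} = {1..N}"
    using assms by auto
  have "(\<lambda>x. x(N := 1 - (\<Sum>i\<in>{1..<N}. x i))) \<in> (\<Pi>\<^sub>M i\<in>{1..<N}. lborel)
      \<rightarrow>\<^sub>M (\<Pi>\<^sub>M i\<in>insert N {1..<N}. (borel :: real measure))"
    by (rule measurable_fun_upd[where J = "{1..<N}"]) (auto intro!: measurable_PiM_single')
  then show "simplex_param N \<in> (\<Pi>\<^sub>M i\<in>{1..<N}. lborel) \<rightarrow>\<^sub>M (\<Pi>\<^sub>M i\<in>{1..N}. borel)"
    unfolding simplex_param_def N .
  show "simplex_param N \<in> simplex_chart N \<rightarrow> open_simplex N"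
    using bij_betw_simplex_param[OF assms] by (auto simp: bij_betw_def)
qed

lemma space_simplex_lebesgue: "space (simplex_lebesgue N) = open_simplex N"
  by (auto simp: simplex_lebesgue_def space_scale_measure space_restrict_space space_PiM
      open_simplex_def PiE_iff extensional_def)

end

theory Submission
  imports Defs
begin

text \<open>Eliminating the last weight through \<open>\<lambda>\<^sub>N = 1 - \<lambda>\<^sub>1 - \<dots> - \<lambda>\<^bsub>N-1\<^esub>\<close> turns every point \<open>u\<close> of the
  effective domain into an affine function of \<open>x = (\<lambda>\<^sub>1, \<dots>, \<lambda>\<^bsub>N-1\<^esub>)\<close>, with constant term
  \<open>f\<^sub>N(u)\<close> and slopes \<open>f\<^sub>i(u) - f\<^sub>N(u)\<close>. The value function is the lower envelope of these affine
  functions, and a minimiser at \<open>x\<close> is one that touches the envelope there. If almost every \<open>x\<close>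
  has the property that all touching functions have the same slopes, then almost every weight has
  the required property: two minimisers share the slopes and the value at \<open>x\<close>, hence also the
  constant term, and these data determine \<open>f(u)\<close>. Points outside the effective domain cannot be
  minimisers, because all weights are positive.

  That two touching functions with different slopes are exceptional is a one-dimensional fact.
  On a line parallel to the \<open>i\<close>-th axis the envelope is concave. Where functions of \<open>i\<close>-th slopes
  \<open>a < b\<close> both touch it, it climbs at rate at most \<open>a\<close> to the right and at least \<open>b\<close> from the
  left. For fixed rational \<open>p < q\<close> in \<open>[a, b]\<close> concavity allows this at one point of the line at
  most (\<open>kink_set_line_inj\<close>), so by Fubini the kinks that belong to \<open>p\<close>, \<open>q\<close> and \<open>i\<close> form a null
  set (\<open>kink_set_null\<close>), and there are countably many triples.

  Fubini needs a measurable set, and the family of affine functions is arbitrary. The kinks are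
  therefore described through the envelope alone, and the envelope is measurable since a countable
  dense subfamily has the same infimum (\<open>borel_measurable_lower_envelope\<close>). Concavity is only used
  between points at which the envelope is finite, so it may be \<open>-\<infinity>\<close> elsewhere.\<close>

section \<open>Lower envelopes of affine functions\<close>

text \<open>An affine function is the pair of its constant term and its vector of slopes, so that a family
  of them is a subset of a separable metric space.\<close>

definition affine_val :: "'i set \<Rightarrow> real \<times> ('i \<Rightarrow> real) \<Rightarrow> ('i \<Rightarrow> real) \<Rightarrow> real" where
  "affine_val I a x = fst a + (\<Sum>i\<in>I. snd a i * x i)"

definition lower_envelope :: "'i set \<Rightarrow> (real \<times> ('i \<Rightarrow> real)) set \<Rightarrow> ('i \<Rightarrow> real) \<Rightarrow> ereal" where
  "lower_envelope I A x = (INF a\<in>A. ereal (affine_val I a x))"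

definition minimisers_at :: "'i set \<Rightarrow> (real \<times> ('i \<Rightarrow> real)) set \<Rightarrow> ('i \<Rightarrow> real) \<Rightarrow> (real \<times> ('i \<Rightarrow> real)) set" where
  "minimisers_at I A x = {a \<in> A. \<forall>b\<in>A. affine_val I a x \<le> affine_val I b x}"

text \<open>At a kink the right-hand derivative along the \<open>i\<close>-th axis is at most \<open>p\<close> and the left-hand one
  at least \<open>q\<close>. Testing the increments \<open>1 / Suc n\<close> is enough by concavity, and keeps the set
  measurable. The set lives on the whole coordinate space, so that the shifted
  arguments never leave the domain.\<close>

definition kink_set :: "'i set \<Rightarrow> (real \<times> ('i \<Rightarrow> real)) set \<Rightarrow> 'i \<Rightarrow> real \<Rightarrow> real \<Rightarrow> ('i \<Rightarrow> real) set" where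
  "kink_set I A i p q = {x \<in> I \<rightarrow>\<^sub>E UNIV. - \<infinity> < lower_envelope I A x \<and> lower_envelope I A x < \<infinity> \<and>
     (\<forall>n. lower_envelope I A (x(i := x i + 1 / Suc n)) \<le> lower_envelope I A x + ereal (p / Suc n) \<and>
          lower_envelope I A (x(i := x i - 1 / Suc n)) \<le> lower_envelope I A x - ereal (q / Suc n))}"

lemma affine_val_upd:
  assumes "finite I" "i \<in> I"
  shows "affine_val I a (x(i := t)) = affine_val I a x + snd a i * (t - x i)"
proof -
  have "(\<Sum>j\<in>I - {i}. snd a j * (x(i := t)) j) = (\<Sum>j\<in>I - {i}. snd a j * x j)"
    by (rule sum.cong) auto
  then show ?thesis
    using assms by (simp add: affine_val_def sum.remove[of I i] algebra_simps)
qed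

text \<open>Concavity along a coordinate line, stated with real lower bounds of the end-point values
  because the envelope may take the value \<open>-\<infinity>\<close>.\<close>

lemma lower_envelope_concave_line:
  assumes I: "finite I" "i \<in> I" and \<theta>: "0 \<le> \<theta>" "\<theta> \<le> 1"
    and s: "ereal \<alpha> \<le> lower_envelope I A (x(i := s))"
    and t: "ereal \<beta> \<le> lower_envelope I A (x(i := t))"
  shows "ereal ((1 - \<theta>) * \<alpha> + \<theta> * \<beta>) \<le> lower_envelope I A (x(i := (1 - \<theta>) * s + \<theta> * t))"
  unfolding lower_envelope_def
proof (rule INF_greatest)
  fix a assume a: "a \<in> A"
  have "\<alpha> \<le> affine_val I a (x(i := s))" "\<beta> \<le> affine_val I a (x(i := t))"
    using s t a unfolding lower_envelope_def le_INF_iff by auto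
  then have "(1 - \<theta>) * \<alpha> + \<theta> * \<beta>
      \<le> (1 - \<theta>) * affine_val I a (x(i := s)) + \<theta> * affine_val I a (x(i := t))"
    using \<theta> by (intro add_mono mult_left_mono) auto
  also have "\<dots> = affine_val I a (x(i := (1 - \<theta>) * s + \<theta> * t))"
    unfolding affine_val_upd[OF I] by (simp add: algebra_simps)
  finally show "ereal ((1 - \<theta>) * \<alpha> + \<theta> * \<beta>)
      \<le> ereal (affine_val I a (x(i := (1 - \<theta>) * s + \<theta> * t)))"
    by simp
qed

text \<open>The value at a fixed point depends continuously on the affine function. A lower bound over a
  dense subfamily therefore holds for the whole family, and an infimum of countably many
  measurable functions is measurable.\<close>

lemma borel_measurable_lower_envelope:
  fixes A :: "(real \<times> ('i::countable \<Rightarrow> real)) set"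
  shows "lower_envelope I A \<in> borel_measurable (\<Pi>\<^sub>M i\<in>I. lborel)"
proof -
  obtain D where D: "countable D" "D \<subseteq> A" "A \<subseteq> closure D"
    using separable[of A] by blast
  have cont: "continuous_on UNIV (\<lambda>a. affine_val I a x)" for x :: "'i \<Rightarrow> real"
    unfolding affine_val_def
    by (intro continuous_intros continuous_on_product_then_coordinatewise)
  have "lower_envelope I A x = (INF a\<in>D. ereal (affine_val I a x))" for x
  proof (rule antisym)
    show "lower_envelope I A x \<le> (INF a\<in>D. ereal (affine_val I a x))"
      unfolding lower_envelope_def by (rule INF_superset_mono) (use D in auto)
    let ?C = "{a. (INF a\<in>D. ereal (affine_val I a x)) \<le> ereal (affine_val I a x)}"
    have "closed ?C"
      by (intro closed_Collect_le continuous_on_ereal cont continuous_on_const)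
    moreover have "D \<subseteq> ?C"
      by (auto intro: INF_lower)
    ultimately have "A \<subseteq> ?C"
      using D(3) closure_minimal by blast
    then show "(INF a\<in>D. ereal (affine_val I a x)) \<le> lower_envelope I A x"
      unfolding lower_envelope_def by (auto intro: INF_greatest)
  qed
  then have "lower_envelope I A = (\<lambda>x. INF a\<in>D. ereal (affine_val I a x))"
    by auto
  also have "\<dots> \<in> borel_measurable (\<Pi>\<^sub>M i\<in>I. lborel)"
    unfolding affine_val_def using D(1) by measurable
  finally show ?thesis .
qed

section \<open>Kinks form a null set\<close>

lemma sets_kink_set:
  fixes A :: "(real \<times> ('i::countable \<Rightarrow> real)) set"
  assumes i: "i \<in> I"
  shows "kink_set I A i p q \<in> sets (\<Pi>\<^sub>M i\<in>I. lborel)"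
proof -
  let ?M = "\<Pi>\<^sub>M i\<in>I. (lborel :: real measure)"
  have E [measurable]: "lower_envelope I A \<in> borel_measurable ?M"
    by (rule borel_measurable_lower_envelope)
  have shift: "(\<lambda>x. lower_envelope I A (x(i := x i + c))) \<in> borel_measurable ?M" for c
    using i by (intro measurable_compose[OF _ E] measurable_fun_upd[where J = I]) auto
  have [measurable]: "Measurable.pred ?M
      (\<lambda>x. lower_envelope I A (x(i := x i + c)) \<le> lower_envelope I A x + ereal d)" for c d
    unfolding pred_def by (intro borel_measurable_le borel_measurable_ereal_add shift E) simp
  have "kink_set I A i p q = {x \<in> space ?M. - \<infinity> < lower_envelope I A x \<and> lower_envelope I A x < \<infinity> \<and>
     (\<forall>n. lower_envelope I A (x(i := x i + 1 / Suc n)) \<le> lower_envelope I A x + ereal (p / Suc n) \<and>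
          lower_envelope I A (x(i := x i + - 1 / Suc n)) \<le> lower_envelope I A x + ereal (- q / Suc n))}"
    by (simp add: kink_set_def space_PiM minus_ereal_def)
  also have "\<dots> \<in> sets ?M"
    by measurable
  finally show ?thesis .
qed

text \<open>For kinks at \<open>s < t\<close> the chord between them would have slope at most \<open>p\<close> when compared with
  the growth just after \<open>s\<close>, and at least \<open>q\<close> when compared with the growth just before \<open>t\<close>.\<close>

lemma kink_set_line_inj:
  assumes I: "finite I" "i \<in> I" and "p < q"
    and s: "x(i := s) \<in> kink_set I A i p q" and t: "x(i := t) \<in> kink_set I A i p q"
  shows "\<not> s < t"
proof
  assume "s < t"
  let ?g = "\<lambda>r. lower_envelope I A (x(i := r))"
  obtain \<alpha> \<beta> where ab: "?g s = ereal \<alpha>" "?g t = ereal \<beta>"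
    using s t by (cases "?g s"; cases "?g t") (auto simp: kink_set_def)
  obtain n where n: "1 / Suc n < t - s"
    using nat_approx_posE[of "t - s"] \<open>s < t\<close> by auto
  define \<delta> where "\<delta> = 1 / real (Suc n)"
  have "0 < \<delta>"
    by (simp add: \<delta>_def)
  \<comment> \<open>The step \<open>\<delta>\<close> away from either end point is the fraction \<open>\<theta>\<close> of the way to the other one.\<close>
  define \<theta> where "\<theta> = \<delta> / (t - s)"
  have \<theta>: "0 < \<theta>" "\<theta> \<le> 1" "\<theta> * (t - s) = \<delta>"
    using n \<open>s < t\<close> unfolding \<delta>_def[symmetric] using \<open>0 < \<delta>\<close> by (auto simp: \<theta>_def)
  have "ereal ((1 - \<theta>) * \<alpha> + \<theta> * \<beta>) \<le> ?g ((1 - \<theta>) * s + \<theta> * t)"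
    using \<theta> ab by (intro lower_envelope_concave_line[OF I]) auto
  also have "(1 - \<theta>) * s + \<theta> * t = s + \<delta>"
    using \<theta>(3) by (simp add: algebra_simps)
  also have "?g (s + \<delta>) \<le> ereal (\<alpha> + p * \<delta>)"
    using s ab by (auto simp: kink_set_def \<delta>_def)
  finally have "\<theta> * (\<beta> - \<alpha>) \<le> p * (\<theta> * (t - s))"
    unfolding \<theta>(3) by (simp add: algebra_simps)
  then have 1: "\<theta> * (\<beta> - \<alpha>) \<le> \<theta> * (p * (t - s))"
    by (simp add: mult_ac)
  have "ereal ((1 - \<theta>) * \<beta> + \<theta> * \<alpha>) \<le> ?g ((1 - \<theta>) * t + \<theta> * s)"
    using \<theta> ab by (intro lower_envelope_concave_line[OF I]) auto
  also have "(1 - \<theta>) * t + \<theta> * s = t - \<delta>"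
    using \<theta>(3) by (simp add: algebra_simps)
  also have "?g (t - \<delta>) \<le> ereal (\<beta> - q * \<delta>)"
    using t ab by (auto simp: kink_set_def \<delta>_def)
  finally have "q * (\<theta> * (t - s)) \<le> \<theta> * (\<beta> - \<alpha>)"
    unfolding \<theta>(3) by (simp add: algebra_simps)
  then have "\<theta> * (q * (t - s)) \<le> \<theta> * (p * (t - s))"
    using 1 by (simp add: mult_ac)
  then show False
    using \<theta>(1) \<open>p < q\<close> \<open>s < t\<close> by simp
qed

text \<open>Fubini in the \<open>i\<close>-th coordinate: each section has at most one point.\<close>

lemma kink_set_null:
  fixes A :: "(real \<times> ('i::countable \<Rightarrow> real)) set"
  assumes I: "finite I" "i \<in> I" and "p < q"
  shows "kink_set I A i p q \<in> null_sets (\<Pi>\<^sub>M i\<in>I. lborel)"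
proof -
  let ?K = "kink_set I A i p q"
  interpret product_sigma_finite "\<lambda>_::'i. lborel :: real measure" ..
  have ins: "insert i (I - {i}) = I"
    using I by auto
  note meas = sets_kink_set[OF I(2), of A p q]
  have line: "(\<integral>\<^sup>+y. indicator ?K (x(i := y)) \<partial>lborel) = 0" for x
  proof -
    let ?Y = "{y. x(i := y) \<in> ?K}"
    have "s = t" if "s \<in> ?Y" "t \<in> ?Y" for s t
      using kink_set_line_inj[OF I \<open>p < q\<close>] that by (metis linorder_neqE mem_Collect_eq)
    then have "?Y = {} \<or> (\<exists>s. ?Y = {s})"
      by blast
    then have "?Y \<in> null_sets lborel"
      by (auto intro: finite_imp_null_set_lborel)
    then have "(\<integral>\<^sup>+y. indicator ?Y y \<partial>lborel) = 0"
      by (subst nn_integral_indicator) auto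
    then show ?thesis
      by (simp add: indicator_def)
  qed
  have "emeasure (\<Pi>\<^sub>M i\<in>I. lborel) ?K = (\<integral>\<^sup>+x. indicator ?K x \<partial>(\<Pi>\<^sub>M i\<in>I. lborel))"
    using meas by simp
  also have "\<dots> = (\<integral>\<^sup>+x. \<integral>\<^sup>+y. indicator ?K (x(i := y)) \<partial>lborel \<partial>(\<Pi>\<^sub>M i\<in>I - {i}. lborel))"
    using product_nn_integral_insert[of "I - {i}" i "indicator ?K"] I meas
    unfolding ins by simp
  also have "\<dots> = 0"
    by (simp add: line)
  finally show ?thesis
    using meas by (auto simp: null_sets_def)
qed

text \<open>A touching affine function bounds the envelope from above everywhere. Moving right, the bound
  from \<open>a\<close> limits the growth; moving left, the bound from \<open>b\<close> forces the descent.\<close>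

lemma kink_at_minimisers:
  assumes I: "finite I" "i \<in> I" and x: "x \<in> I \<rightarrow>\<^sub>E UNIV"
    and a: "a \<in> minimisers_at I A x" and b: "b \<in> minimisers_at I A x"
    and "snd a i \<le> p" "q \<le> snd b i"
  shows "x \<in> kink_set I A i p q"
proof -
  have val: "lower_envelope I A x = ereal (affine_val I c x)" if "c \<in> minimisers_at I A x" for c
    using that unfolding lower_envelope_def minimisers_at_def
    by (intro antisym INF_lower INF_greatest) auto
  have bound: "lower_envelope I A (x(i := r)) \<le> lower_envelope I A x + ereal (snd c i * (r - x i))"
    if c: "c \<in> minimisers_at I A x" for c r
  proof -
    have "lower_envelope I A (x(i := r)) \<le> ereal (affine_val I c (x(i := r)))"
      using c unfolding lower_envelope_def minimisers_at_def by (auto intro: INF_lower)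
    then show ?thesis
      by (simp add: val[OF c] affine_val_upd[OF I])
  qed
  have "lower_envelope I A (x(i := x i + 1 / Suc n)) \<le> lower_envelope I A x + ereal (p / Suc n)" for n
    by (rule order_trans[OF bound[OF a] add_left_mono])
      (use \<open>snd a i \<le> p\<close> in \<open>simp add: divide_right_mono\<close>)
  moreover have "lower_envelope I A (x(i := x i - 1 / Suc n)) \<le> lower_envelope I A x - ereal (q / Suc n)" for n
    using order_trans[OF bound[OF b, of "x i - 1 / Suc n"] add_left_mono, of "ereal (- (q / Suc n))"]
      \<open>q \<le> snd b i\<close> by (simp add: val[OF a] divide_right_mono)
  ultimately show ?thesis
    using x val[OF a] by (simp add: kink_set_def)
qed

text \<open>The countably many pairs of rationals suffice, since two distinct slopes have room for
  \<open>p < q\<close> between them.\<close>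

lemma AE_minimisers_same_slope:
  fixes A :: "(real \<times> ('i::countable \<Rightarrow> real)) set"
  assumes I: "finite I"
  shows "AE x in \<Pi>\<^sub>M i\<in>I. lborel.
    \<forall>a\<in>minimisers_at I A x. \<forall>b\<in>minimisers_at I A x. \<forall>i\<in>I. snd a i = snd b i"
proof (rule AE_I')
  define P where "P = {(p, q). p \<in> \<rat> \<and> q \<in> \<rat> \<and> p < (q::real)}"
  have "P \<subseteq> \<rat> \<times> \<rat>"
    by (auto simp: P_def)
  then have "countable P"
    by (rule countable_subset) (simp add: countable_rat)
  show "(\<Union>i\<in>I. \<Union>(p, q)\<in>P. kink_set I A i p q) \<in> null_sets (\<Pi>\<^sub>M i\<in>I. lborel)"
    using \<open>countable P\<close>
    by (intro null_sets_UN' countable_finite[OF I])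
      (auto simp: P_def intro!: kink_set_null[OF I])
  have kink: "x \<in> (\<Union>i\<in>I. \<Union>(p, q)\<in>P. kink_set I A i p q)"
    if slopes: "snd a i < snd b i" and at: "i \<in> I" "x \<in> I \<rightarrow>\<^sub>E UNIV"
      "a \<in> minimisers_at I A x" "b \<in> minimisers_at I A x" for x a b i
  proof -
    obtain p where p: "p \<in> \<rat>" "snd a i < p" "p < snd b i"
      using Rats_dense_in_real[OF slopes] by blast
    obtain q where q: "q \<in> \<rat>" "p < q" "q < snd b i"
      using Rats_dense_in_real[OF p(3)] by blast
    have "x \<in> kink_set I A i p q"
      using p q by (intro kink_at_minimisers[OF I at]) auto
    moreover have "(p, q) \<in> P"
      using p q by (simp add: P_def)
    ultimately show ?thesis
      using \<open>i \<in> I\<close> by blast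
  qed
  show "{x \<in> space (\<Pi>\<^sub>M i\<in>I. lborel). \<not> (\<forall>a\<in>minimisers_at I A x. \<forall>b\<in>minimisers_at I A x.
      \<forall>i\<in>I. snd a i = snd b i)} \<subseteq> (\<Union>i\<in>I. \<Union>(p, q)\<in>P. kink_set I A i p q)"
  proof
    fix x assume "x \<in> {x \<in> space (\<Pi>\<^sub>M i\<in>I. lborel). \<not> (\<forall>a\<in>minimisers_at I A x.
      \<forall>b\<in>minimisers_at I A x. \<forall>i\<in>I. snd a i = snd b i)}"
    then obtain a b i where "x \<in> I \<rightarrow>\<^sub>E UNIV" "a \<in> minimisers_at I A x" "b \<in> minimisers_at I A x"
      "i \<in> I" "snd a i \<noteq> snd b i"
      by (auto simp: space_PiM)
    then show "x \<in> (\<Union>i\<in>I. \<Union>(p, q)\<in>P. kink_set I A i p q)"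
      using kink[of a i b x] kink[of b i a x] by linarith
  qed
qed

section \<open>Transfer to the simplex\<close>

text \<open>A null set of the chart gives one of the simplex. Since \<open>P\<close> need not be measurable, the
  exceptional set is first enlarged to a measurable null set \<open>Z\<close> of coordinates; its preimage under
  the projection to the first \<open>N - 1\<close> coordinates, the inverse of the chart map, is then
  measurable in the simplex.\<close>

lemma AE_simplex_lebesgueI:
  assumes N: "N \<ge> 1" and chart: "AE x in \<Pi>\<^sub>M i\<in>{1..<N}. lborel. Q x"
    and imp: "\<And>x. x \<in> simplex_chart N \<Longrightarrow> Q x \<Longrightarrow> P (simplex_param N x)"
  shows "AE l in simplex_lebesgue N. P l"
proof -
  let ?M = "\<Pi>\<^sub>M i\<in>{1..<N}. (lborel :: real measure)"
  let ?S = "restrict_space (\<Pi>\<^sub>M i\<in>{1..N}. (borel :: real measure)) (open_simplex N)"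
  let ?R = "restrict_space ?M (simplex_chart N)"
  obtain Z where Z: "Z \<in> null_sets ?M" "{x \<in> space ?M. \<not> Q x} \<subseteq> Z"
    using chart by (auto simp: eventually_ae_filter)
  have Z' [measurable]: "Z \<in> sets ?M"
    using Z by auto
  have "(\<lambda>l. restrict l {1..<N}) \<in> (\<Pi>\<^sub>M i\<in>{1..N}. (borel :: real measure)) \<rightarrow>\<^sub>M ?M"
    by (auto intro!: measurable_restrict measurable_component_singleton)
  then have "(\<lambda>l. restrict l {1..<N}) \<in> ?S \<rightarrow>\<^sub>M ?M"
    by (rule measurable_restrict_space1)
  moreover have "Measurable.pred ?M (\<lambda>x. x \<notin> Z)"
    by measurable
  ultimately have "Measurable.pred ?S (\<lambda>l. restrict l {1..<N} \<notin> Z)"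
    by (rule measurable_compose)
  then have sets_Z: "{l \<in> space ?S. restrict l {1..<N} \<notin> Z} \<in> sets ?S"
    unfolding pred_def .
  have "AE x in ?R. x \<notin> Z"
    using AE_not_in[OF Z(1)] by (subst AE_restrict_space_iff[OF sets.Int[OF sets_simplex_chart sets.top]]) auto
  then have "AE x in ?R. restrict (simplex_param N x) {1..<N} \<notin> Z"
  proof (rule AE_mp, intro AE_I2 impI)
    fix x assume "x \<in> space ?R" "x \<notin> Z"
    moreover from this have "restrict (simplex_param N x) {1..<N} = x"
      by (auto simp: space_restrict_space simplex_chart_def simplex_param_def PiE_iff
          extensional_def restrict_def)
    ultimately show "restrict (simplex_param N x) {1..<N} \<notin> Z"
      by simp
  qed
  then have "AE l in distr ?R ?S (simplex_param N). restrict l {1..<N} \<notin> Z"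
    by (subst AE_distr_iff[OF measurable_simplex_param[OF N] sets_Z])
  then have "AE l in distr ?R ?S (simplex_param N). P l"
  proof (rule AE_mp, intro AE_I2 impI)
    fix l assume l: "l \<in> space (distr ?R ?S (simplex_param N))" "restrict l {1..<N} \<notin> Z"
    then have "l \<in> open_simplex N"
      by (simp add: space_restrict_space)
    then obtain x where x: "x \<in> simplex_chart N" "l = simplex_param N x"
      using bij_betw_simplex_param[OF N] by (auto simp: bij_betw_def)
    then have "restrict l {1..<N} = x"
      by (auto simp: simplex_chart_def simplex_param_def PiE_iff extensional_def restrict_def)
    moreover have "x \<in> space ?M"
      using x(1) by (auto simp: simplex_chart_def space_PiM PiE_iff)
    ultimately have "Q x"
      using l(2) Z(2) by auto
    then show "P l"
      using imp x by blast
  qed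
  \<comment> \<open>Scaling the measure by a constant keeps null sets null.\<close>
  then obtain Y where Y: "Y \<in> null_sets (distr ?R ?S (simplex_param N))"
      "{l \<in> space (distr ?R ?S (simplex_param N)). \<not> P l} \<subseteq> Y"
    by (auto simp: eventually_ae_filter)
  have "Y \<in> null_sets (simplex_lebesgue N)"
    using Y(1) by (auto simp: null_sets_def simplex_lebesgue_def)
  then show ?thesis
    by (rule AE_I') (use Y(2) in \<open>auto simp: simplex_lebesgue_def space_scale_measure\<close>)
qed

text \<open>The weighted sum with objective vector \<open>y\<close>, as an affine function on the chart: eliminating
  \<open>\<lambda>\<^sub>N\<close> makes \<open>y\<^sub>N\<close> the constant term. Finite entries are intended, as \<open>real_of_ereal\<close> sends
  infinite ones to \<open>0\<close>.\<close>

definition chart_affine :: "nat \<Rightarrow> (nat \<Rightarrow> ereal) \<Rightarrow> real \<times> (nat \<Rightarrow> real)" where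
  "chart_affine N y = (real_of_ereal (y N), \<lambda>i. real_of_ereal (y i) - real_of_ereal (y N))"

lemma weighted_sum_simplex_param:
  assumes N: "N \<ge> 1" and fin: "\<And>i. i \<in> {1..N} \<Longrightarrow> \<bar>f u i\<bar> \<noteq> \<infinity>"
  shows "weighted_sum N f (simplex_param N x) u
    = ereal (affine_val {1..<N} (chart_affine N (f u)) x)"
proof -
  let ?r = "\<lambda>i. real_of_ereal (f u i)"
  have "weighted_sum N f (simplex_param N x) u = (\<Sum>i=1..N. ereal (simplex_param N x i * ?r i))"
    unfolding weighted_sum_def 
  proof (rule sum.cong)
    fix i assume "i \<in> {1..N}"
    then show "ereal (simplex_param N x i) * f u i = ereal (simplex_param N x i * ?r i)"
      using fin[of i] by (cases "f u i") auto
  qed simp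
  also have "\<dots> = ereal (\<Sum>i=1..N. simplex_param N x i * ?r i)"
    by simp
  also have "(\<Sum>i=1..N. simplex_param N x i * ?r i)
      = (\<Sum>i\<in>{1..<N}. simplex_param N x i * ?r i) + simplex_param N x N * ?r N"
    using N by (simp add: sum.last_plus add.commute)
  also have "(\<Sum>i\<in>{1..<N}. simplex_param N x i * ?r i) = (\<Sum>i\<in>{1..<N}. x i * ?r i)"
    by (rule sum.cong) (auto simp: simplex_param_def)
  also have "\<dots> + simplex_param N x N * ?r N = affine_val {1..<N} (chart_affine N (f u)) x"
    by (simp add: affine_val_def chart_affine_def simplex_param_def algebra_simps
        sum_subtractf sum_distrib_left)
  finally show ?thesis .
qed

text \<open>Positive weights turn an infinite objective into an infinite sum, whereas a point of the
  effective domain keeps the infimum below \<open>\<infinity>\<close>.\<close>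

lemma argmin_on_subset_eff_dom:
  assumes l: "\<And>i. i \<in> {1..N} \<Longrightarrow> l i > 0" and dom: "eff_dom N U f \<noteq> {}"
  shows "argmin_on U (weighted_sum N f l) \<subseteq> eff_dom N U f"
proof
  fix u assume u: "u \<in> argmin_on U (weighted_sum N f l)"
  obtain v where v: "v \<in> U" "\<And>i. i \<in> {1..N} \<Longrightarrow> f v i < \<infinity>"
    using dom by (auto simp: eff_dom_def)
  have "ereal (l i) * f v i \<noteq> \<infinity>" if "i \<in> {1..N}" for i
    using v(2)[OF that] l[OF that] by (cases "f v i") auto
  then have "weighted_sum N f l v \<noteq> \<infinity>"
    by (simp add: weighted_sum_def sum_Pinfty)
  moreover have "weighted_sum N f l u \<le> weighted_sum N f l v"
    using u v(1) by (auto simp: argmin_on_def intro: INF_lower)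
  ultimately have "weighted_sum N f l u \<noteq> \<infinity>"
    by auto
  then have "f u i < \<infinity>" if "i \<in> {1..N}" for i
    using l[OF that] that by (cases "f u i") (force simp: weighted_sum_def sum_Pinfty)+
  then show "u \<in> eff_dom N U f"
    using u by (auto simp: eff_dom_def argmin_on_def)
qed

theorem theorem3p1:
  fixes N :: nat and U :: "'u set" and f :: "'u \<Rightarrow> nat \<Rightarrow> ereal"
  assumes "N \<ge> 2"
    and "U \<noteq> {}"
    and "f \<in> U \<rightarrow> ({1..N} \<rightarrow>\<^sub>E {-\<infinity><..})"
    and "eff_dom N U f \<noteq> {}"
  shows "(AE l in simplex_lebesgue N.
           \<forall>u1\<in>argmin_on U (weighted_sum N f l). \<forall>u2\<in>argmin_on U (weighted_sum N f l). f u1 = f u2)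
       \<and> (AE l in simplex_lebesgue N.
           \<exists>\<^sub>\<le>\<^sub>1 y. y \<in> f ` argmin_on U (weighted_sum N f l))"
proof -
  define A where "A = (\<lambda>u. chart_affine N (f u)) ` eff_dom N U f"
  have N: "N \<ge> 1"
    using assms(1) by simp
  have fin: "\<bar>f u i\<bar> \<noteq> \<infinity>" if "u \<in> eff_dom N U f" "i \<in> {1..N}" for u i
  proof -
    have "f u i < \<infinity>" "- \<infinity> < f u i"
      using that assms(3) by (auto simp: eff_dom_def PiE_iff Pi_iff)
    then show ?thesis by auto
  qed
  have *: "AE l in simplex_lebesgue N.
    \<forall>u1\<in>argmin_on U (weighted_sum N f l). \<forall>u2\<in>argmin_on U (weighted_sum N f l). f u1 = f u2"
  proof (rule AE_simplex_lebesgueI[OF N AE_minimisers_same_slope[of "{1..<N}" A]])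
    fix x
    assume x: "x \<in> simplex_chart N" and same: "\<forall>a\<in>minimisers_at {1..<N} A x.
      \<forall>b\<in>minimisers_at {1..<N} A x. \<forall>i\<in>{1..<N}. snd a i = snd b i"
    let ?H = "weighted_sum N f (simplex_param N x)"
    have "simplex_param N x \<in> open_simplex N"
      using bij_betw_simplex_param[OF N] x by (auto simp: bij_betw_def)
    then have dom: "argmin_on U ?H \<subseteq> eff_dom N U f"
      using assms(4) by (intro argmin_on_subset_eff_dom) (auto simp: open_simplex_def PiE_iff)
    have val: "?H u = ereal (affine_val {1..<N} (chart_affine N (f u)) x)" if "u \<in> eff_dom N U f" for u
      by (rule weighted_sum_simplex_param[where f = f and u = u, OF N fin[OF that]])
    have min: "chart_affine N (f u) \<in> minimisers_at {1..<N} A x" if u: "u \<in> argmin_on U ?H" for u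
    proof -
      have "?H u \<le> ?H v" if "v \<in> eff_dom N U f" for v
        using u that by (auto simp: argmin_on_def eff_dom_def intro: INF_lower)
      then show ?thesis
        using u dom val by (auto simp: minimisers_at_def A_def)
    qed
    show "\<forall>u1\<in>argmin_on U ?H. \<forall>u2\<in>argmin_on U ?H. f u1 = f u2"
    proof (intro ballI)
      fix u1 u2 assume u: "u1 \<in> argmin_on U ?H" "u2 \<in> argmin_on U ?H"
      let ?r1 = "\<lambda>i. real_of_ereal (f u1 i)" and ?r2 = "\<lambda>i. real_of_ereal (f u2 i)"
      have d: "u1 \<in> eff_dom N U f" "u2 \<in> eff_dom N U f"
        using u dom by auto
      have slopes: "snd (chart_affine N (f u1)) i = snd (chart_affine N (f u2)) i" if "i \<in> {1..<N}" for i
        using same min[OF u(1)] min[OF u(2)] that by blast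
      then have "(\<Sum>i\<in>{1..<N}. snd (chart_affine N (f u1)) i * x i)
          = (\<Sum>i\<in>{1..<N}. snd (chart_affine N (f u2)) i * x i)"
        by (intro sum.cong) auto
      moreover have "?H u1 = ?H u2"
        using u by (simp add: argmin_on_def)
      ultimately have "fst (chart_affine N (f u1)) = fst (chart_affine N (f u2))"
        unfolding val[OF d(1)] val[OF d(2)] by (simp add: affine_val_def)
      \<comment> \<open>Equal slopes and equal values leave equal constant terms, which are the last objectives.\<close>
      then have last: "?r1 N = ?r2 N"
        by (simp add: chart_affine_def)
      then have slope: "?r1 i = ?r2 i" if "i \<in> {1..<N}" for i
        using slopes[OF that] by (simp add: chart_affine_def)
      have "?r1 i = ?r2 i" if "i \<in> {1..N}" for i
        using that slope[of i] last by (cases "i = N") auto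
      then have "f u1 i = f u2 i" if "i \<in> {1..N}" for i
        using fin[OF d(1) that] fin[OF d(2) that] that by (metis ereal_real')
      moreover have "f u1 \<in> extensional {1..N}" "f u2 \<in> extensional {1..N}"
        using u assms(3) by (auto simp: argmin_on_def PiE_def)
      ultimately show "f u1 = f u2"
        by (blast intro: extensionalityI)
    qed
  qed simp
  moreover have "AE l in simplex_lebesgue N. \<exists>\<^sub>\<le>\<^sub>1 y. y \<in> f ` argmin_on U (weighted_sum N f l)"
    using * by (rule eventually_mono) (unfold Uniq_def, blast)
  ultimately show ?thesis ..
qed

end
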